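(* If $\Delta$ is any simplicial complex of subsets of $\{1,\dots,n\}$, then in $S_\Delta$ $$P_\Delta=\sqrt{K_\Delta+Q_\Delta},$$ where $P_\Delta=\ker\sigma_\Delta$, $K_\Delta=\ker\tau_\Delta$ and $Q_\Delta=\ker\eta_\Delta$.
   Context: $\mathbb K$ is a field, $a_1,\dots,a_n$ positive integers, $R=\mathbb K[x_{i_1,\dots,i_n}:1\le i_j\le a_j]$. For a tuple $\sigma$ with $\sigma_j\in\{1,\dots,a_j\}\cup\{+\}$, $x_\sigma$ is the sum of all $x_{i_1,\dots,i_n}$ with $i_j=\sigma_j$ whenever $\sigma_j\ne+$. A simplicial complex is a nonempty family of subsets of $\{1,\dots,n\}$ closed under subsets. $S_\Delta$ is the polynomial ring over $\mathbb K$ in variables $X_\sigma$, one for each tuple $\sigma$ with $\sigma_j\in\{1,\dots,a_j\}\cup\{\bullet\}$ and $\{j:\sigma_j\ne\bullet\}\in\Delta$. $\tau_\Delta:S_\Delta\to R$ sends $X_\sigma\mapsto x_{\sigma''}$, where $\sigma''$ replaces each $\bullet$ by $+$. $\sigma_\Delta:S_\Delta\to\mathbb K[y_{j,i}:1\le j\le n,1\le i\le a_j]$ sends $X_\sigma\mapsto\prod_j y_{j,\sigma_j}$, where $y_{j,\bullet}$ is interpreted as $y_{j,+}=\sum_{i=1}^{a_j}y_{j,i}$ (equivalently, $\sigma_\Delta$ is $\tau_\Delta$ followed by the Segre map $x_{i_1,\dots,i_n}\mapsto\prod_j y_{j,i_j}$). $\eta_\Delta:S_\Delta\to\mathbb K[y_{j,i}:1\le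 j\le n,\ i\in\{1,\dots,a_j\}\cup\{\bullet\}]$, where the $y_{j,\bullet}$ are new independent variables, sends $X_\sigma\mapsto\prod_j y_{j,\sigma_j}$. *)

theory Defs
  imports "HOL-Library.Poly_Mapping"
begin

type_synonym ('v, 'k) mpoly = "('v \<Rightarrow>\<^sub>0 nat) \<Rightarrow>\<^sub>0 'k"

definition MVar :: "'v \<Rightarrow> ('v, 'k::comm_semiring_1) mpoly" where
  "MVar v = Poly_Mapping.single (Poly_Mapping.single v 1) 1"

definition MConst :: "'k \<Rightarrow> ('v, 'k::comm_semiring_1) mpoly" where
  "MConst c = Poly_Mapping.single 0 c"

definition mvars :: "('v, 'k::zero) mpoly \<Rightarrow> 'v set" where
  "mvars p = (\<Union>m\<in>Poly_Mapping.keys p. Poly_Mapping.keys m)"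

definition msubst :: "('v \<Rightarrow> ('w, 'k::comm_ring_1) mpoly) \<Rightarrow> ('v, 'k) mpoly \<Rightarrow> ('w, 'k) mpoly" where
  "msubst f p = (\<Sum>m\<in>Poly_Mapping.keys p. MConst (Poly_Mapping.lookup p m) * (\<Prod>v\<in>Poly_Mapping.keys m. f v ^ Poly_Mapping.lookup m v))"

text \<open>Tuples \<sigma> are encoded as functions nat \<Rightarrow> nat; only positions 1..n matter and the
  value 0 encodes the symbol bullet (resp. +).  Valid tuples have \<sigma> j = 0 outside {1..n}.\<close>

definition tuples :: "nat \<Rightarrow> (nat \<Rightarrow> nat) \<Rightarrow> (nat \<Rightarrow> nat) set" where
  "tuples n a = {\<sigma>. (\<forall>j\<in>{1..n}. \<sigma> j \<le> a j) \<and> (\<forall>j. j \<notin> {1..n} \<longrightarrow> \<sigma> j = 0)}"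

definition full_tuples :: "nat \<Rightarrow> (nat \<Rightarrow> nat) \<Rightarrow> (nat \<Rightarrow> nat) set" where
  "full_tuples n a = {i. (\<forall>j\<in>{1..n}. 1 \<le> i j \<and> i j \<le> a j) \<and> (\<forall>j. j \<notin> {1..n} \<longrightarrow> i j = 0)}"

definition support :: "nat \<Rightarrow> (nat \<Rightarrow> nat) \<Rightarrow> nat set" where
  "support n \<sigma> = {j\<in>{1..n}. \<sigma> j \<noteq> 0}"

definition simplicial_complex :: "nat \<Rightarrow> nat set set \<Rightarrow> bool" where
  "simplicial_complex n \<Delta> \<longleftrightarrow> \<Delta> \<noteq> {} \<and> (\<forall>F\<in>\<Delta>. F \<subseteq> {1..n}) \<and> (\<forall>F\<in>\<Delta>. \<forall>G. G \<subseteq> F \<longrightarrow> G \<in> \<Delta>)"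

definition S_vars :: "nat \<Rightarrow> (nat \<Rightarrow> nat) \<Rightarrow> nat set set \<Rightarrow> (nat \<Rightarrow> nat) set" where
  "S_vars n a \<Delta> = {\<sigma>\<in>tuples n a. support n \<sigma> \<in> \<Delta>}"

definition S_ring :: "nat \<Rightarrow> (nat \<Rightarrow> nat) \<Rightarrow> nat set set \<Rightarrow> (nat \<Rightarrow> nat, 'k::zero) mpoly set" where
  "S_ring n a \<Delta> = {p. mvars p \<subseteq> S_vars n a \<Delta>}"

definition x_plus :: "nat \<Rightarrow> (nat \<Rightarrow> nat) \<Rightarrow> (nat \<Rightarrow> nat) \<Rightarrow> (nat \<Rightarrow> nat, 'k::comm_ring_1) mpoly" where
  "x_plus n a \<sigma> = (\<Sum>i\<in>{i\<in>full_tuples n a. \<forall>j\<in>{1..n}. \<sigma> j \<noteq> 0 \<longrightarrow> i j = \<sigma> j}. MVar i)"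

definition tau :: "nat \<Rightarrow> (nat \<Rightarrow> nat) \<Rightarrow> (nat \<Rightarrow> nat, 'k::comm_ring_1) mpoly \<Rightarrow> (nat \<Rightarrow> nat, 'k) mpoly" where
  "tau n a = msubst (x_plus n a)"

text \<open>y_{j,i}; y_{j,bullet} interpreted as y_{j,+}.\<close>
definition y_sig :: "(nat \<Rightarrow> nat) \<Rightarrow> nat \<Rightarrow> nat \<Rightarrow> (nat \<times> nat, 'k::comm_ring_1) mpoly" where
  "y_sig a j i = (if i = 0 then (\<Sum>l\<in>{1..a j}. MVar (j, l)) else MVar (j, i))"

definition sigma :: "nat \<Rightarrow> (nat \<Rightarrow> nat) \<Rightarrow> (nat \<Rightarrow> nat, 'k::comm_ring_1) mpoly \<Rightarrow> (nat \<times> nat, 'k) mpoly" where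
  "sigma n a = msubst (\<lambda>\<sigma>. \<Prod>j\<in>{1..n}. y_sig a j (\<sigma> j))"

text \<open>eta: y_{j,bullet} is the new independent variable (j, 0).\<close>
definition eta :: "nat \<Rightarrow> (nat \<Rightarrow> nat, 'k::comm_ring_1) mpoly \<Rightarrow> (nat \<times> nat, 'k) mpoly" where
  "eta n = msubst (\<lambda>\<sigma>. \<Prod>j\<in>{1..n}. MVar (j, \<sigma> j))"

definition kernel_in :: "'a set \<Rightarrow> ('a \<Rightarrow> 'b::zero) \<Rightarrow> 'a set" where
  "kernel_in S f = {p\<in>S. f p = 0}"

definition ideal_sum :: "'a::plus set \<Rightarrow> 'a set \<Rightarrow> 'a set" where
  "ideal_sum I J = {x + y | x y. x \<in> I \<and> y \<in> J}"

definition radical_in :: "'a::monoid_mult set \<Rightarrow> 'a set \<Rightarrow> 'a set" where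
  "radical_in S I = {p\<in>S. \<exists>k::nat. p ^ k \<in> I}"

end

theory Submission
  imports Defs "HOL-Library.FuncSet" "HOL-Library.Product_Lexorder"
begin

text \<open>
  In fact \<open>P = K + Q\<close>. Modulo \<open>K\<close>, the relations
  \<open>X\<^bsub>\<sigma>(j:=\<bullet>)\<^esub> = \<Sum>\<^sub>i X\<^bsub>\<sigma>(j:=i)\<^esub>\<close> eliminate every variable in which some
  \<open>\<sigma>\<^sub>j\<close> equals \<open>a\<^sub>j\<close>. On the remaining variables only \<open>y\<^bsub>j,+\<^esub>\<close> and \<open>y\<^bsub>j,i\<^esub>\<close> with
  \<open>i < a\<^sub>j\<close> occur in the image of the map \<open>\<sigma>\<^sub>\<Delta>\<close>; these are again coordinates of the
  polynomial ring, so that \<open>\<sigma>\<^sub>\<Delta>\<close> and \<open>\<eta>\<^sub>\<Delta>\<close> have the same kernel there. Conversely,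
  \<open>\<sigma>\<^sub>\<Delta>\<close> factors through both \<open>\<tau>\<^sub>\<Delta>\<close> and \<open>\<eta>\<^sub>\<Delta>\<close>, and its target is a domain.
\<close>

section \<open>Substitution as a ring homomorphism\<close>

definition monom_subst :: "('v \<Rightarrow> 'b::comm_monoid_mult) \<Rightarrow> ('v \<Rightarrow>\<^sub>0 nat) \<Rightarrow> 'b" where
  "monom_subst f m = (\<Prod>v\<in>Poly_Mapping.keys m. f v ^ Poly_Mapping.lookup m v)"

text \<open>Exponents outside the support are 0, so extra factors are 1. This lets the products for
  \<open>m\<close>, \<open>m'\<close> and \<open>m + m'\<close> be compared over one index
  set.\<close>

lemma monom_subst_superset:
  assumes "finite A" "Poly_Mapping.keys m \<subseteq> A"
  shows "monom_subst f m = (\<Prod>v\<in>A. f v ^ Poly_Mapping.lookup m v)"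
  unfolding monom_subst_def using assms
  by (intro prod.mono_neutral_left) (auto simp: in_keys_iff)

lemma monom_subst_add: "monom_subst f (m + m') = monom_subst f m * monom_subst f m'"
proof -
  let ?A = "Poly_Mapping.keys m \<union> Poly_Mapping.keys m'"
  have A: "finite ?A" "Poly_Mapping.keys (m + m') \<subseteq> ?A"
    using Poly_Mapping.keys_add[of m m'] by auto
  show ?thesis
    by (simp add: monom_subst_superset[OF A] monom_subst_superset[OF A(1), of m]
        monom_subst_superset[OF A(1), of m'] lookup_add power_add prod.distrib)
qed

lemma monom_subst_0 [simp]: "monom_subst f 0 = 1"
  by (simp add: monom_subst_def)

lemma monom_subst_single [simp]: "monom_subst f (Poly_Mapping.single v k) = f v ^ k"
  by (simp add: monom_subst_def)

lemma MConst_0 [simp]: "MConst 0 = 0"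
  and MConst_1 [simp]: "MConst 1 = 1"
  and MConst_add: "MConst (c + d) = MConst c + MConst d"
  and MConst_mult: "MConst (c * d) = MConst c * MConst d"
  by (simp_all add: MConst_def single_add mult_single)

lemma msubst_superset:
  assumes "finite A" "Poly_Mapping.keys p \<subseteq> A"
  shows "msubst f p = (\<Sum>m\<in>A. MConst (Poly_Mapping.lookup p m) * monom_subst f m)"
  unfolding msubst_def monom_subst_def using assms
  by (intro sum.mono_neutral_left) (auto simp: in_keys_iff)

lemma msubst_add: "msubst f (p + q) = msubst f p + msubst f q"
proof -
  let ?A = "Poly_Mapping.keys p \<union> Poly_Mapping.keys q"
  have A: "finite ?A" "Poly_Mapping.keys (p + q) \<subseteq> ?A"
    using Poly_Mapping.keys_add[of p q] by auto
  show ?thesis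
    by (simp add: msubst_superset[OF A] msubst_superset[OF A(1), of p]
        msubst_superset[OF A(1), of q] lookup_add MConst_add distrib_right sum.distrib)
qed

lemma msubst_single: "msubst f (Poly_Mapping.single m c) = MConst c * monom_subst f m"
  by (simp add: msubst_def monom_subst_def)

lemma msubst_0 [simp]: "msubst f 0 = 0"
  by (simp add: msubst_def)

lemma msubst_MConst [simp]: "msubst f (MConst c) = MConst c"
  by (simp add: MConst_def msubst_single)

lemma msubst_1 [simp]: "msubst f 1 = 1"
  using msubst_MConst[of f 1] by simp

lemma msubst_MVar [simp]: "msubst f (MVar v) = f v"
  by (simp add: MVar_def msubst_single)

text \<open>Updating at a fresh key is the same as adding a \<open>single\<close>. The rule reduces
  multiplicativity of \<open>msubst\<close> to products of two terms.\<close>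

lemma poly_mapping_add_induct [case_names single add]:
  fixes p :: "'a \<Rightarrow>\<^sub>0 'b::comm_monoid_add"
  assumes "\<And>m c. P (Poly_Mapping.single m c)" "\<And>p q. P p \<Longrightarrow> P q \<Longrightarrow> P (p + q)"
  shows "P p"
proof (induction p rule: update_induct)
  case const
  show ?case using assms(1)[of _ 0] by simp
next
  case (update p m c)
  have "Poly_Mapping.update m c p = Poly_Mapping.single m c + p"
    using update(1)
    by (intro poly_mapping_eqI) (auto simp: lookup_update lookup_add lookup_single in_keys_iff when_def)
  then show ?case using assms update by simp
qed

lemma msubst_mult: "msubst f (p * q) = msubst f p * msubst f q"
proof (induction p rule: poly_mapping_add_induct)
  case (single m c)
  show ?case
  proof (induction q rule: poly_mapping_add_induct)
    case (single m' c')
    show ?case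
      by (simp add: msubst_single mult_single monom_subst_add MConst_mult mult_ac)
  next
    case (add q q')
    then show ?case by (simp add: distrib_left msubst_add)
  qed
next
  case (add p p')
  then show ?case by (simp add: distrib_right msubst_add)
qed

lemma msubst_diff: "msubst f (p - q) = msubst f p - msubst f q"
  using msubst_add[of f "p - q" q] by simp

lemma msubst_power: "msubst f (p ^ k) = msubst f p ^ k"
  by (induction k) (simp_all add: msubst_mult)

lemma msubst_sum: "msubst f (\<Sum>i\<in>I. g i) = (\<Sum>i\<in>I. msubst f (g i))"
  by (induction I rule: infinite_finite_induct) (simp_all add: msubst_add)

lemma msubst_prod: "msubst f (\<Prod>i\<in>I. g i) = (\<Prod>i\<in>I. msubst f (g i))"
  by (induction I rule: infinite_finite_induct) (simp_all add: msubst_mult)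

lemma msubst_msubst: "msubst g (msubst f p) = msubst (\<lambda>v. msubst g (f v)) p"
  unfolding msubst_def[of f p] msubst_def[of "\<lambda>v. msubst g (f v)" p]
  by (simp add: msubst_sum msubst_mult msubst_prod msubst_power)

text \<open>The substitutions act on polynomials in arbitrary tuples; this lemma is where the
  restriction to admissible tuples enters.\<close>

lemma msubst_cong:
  assumes "\<And>v. v \<in> mvars p \<Longrightarrow> f v = g v"
  shows "msubst f p = msubst g p"
  unfolding msubst_def using assms
  by (intro sum.cong refl arg_cong2[of _ _ _ _ "(*)"] prod.cong arg_cong2[of _ _ _ _ "(^)"])
    (auto simp: mvars_def)

section \<open>Variables occurring in a polynomial\<close>

lemma mvars_0 [simp]: "mvars 0 = {}"
  by (simp add: mvars_def)

lemma mvars_MConst [simp]: "mvars (MConst c) = {}"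
  by (simp add: mvars_def MConst_def)

lemma mvars_1 [simp]: "mvars (1 :: ('v, 'k::comm_semiring_1) mpoly) = {}"
  using mvars_MConst[of 1] by simp

lemma mvars_MVar [simp]: "mvars (MVar v :: ('v, 'k::comm_semiring_1) mpoly) = {v}"
  by (simp add: mvars_def MVar_def)

lemma mvars_add: "mvars (p + q) \<subseteq> mvars p \<union> mvars q"
  using Poly_Mapping.keys_add[of p q] by (auto simp: mvars_def)

lemma mvars_diff:
  fixes p q :: "('v, 'k::ab_group_add) mpoly"
  shows "mvars (p - q) \<subseteq> mvars p \<union> mvars q"
  using keys_diff[of p q] by (auto simp: mvars_def)

lemma mvars_mult: "mvars (p * q) \<subseteq> mvars p \<union> mvars q"
proof
  fix v assume "v \<in> mvars (p * q)"
  then obtain m where m: "m \<in> Poly_Mapping.keys (p * q)" "v \<in> Poly_Mapping.keys m"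
    by (auto simp: mvars_def)
  then obtain s t where "m = s + t" "s \<in> Poly_Mapping.keys p" "t \<in> Poly_Mapping.keys q"
    using keys_mult[of p q] by blast
  then show "v \<in> mvars p \<union> mvars q"
    using m(2) Poly_Mapping.keys_add[of s t] by (auto simp: mvars_def)
qed

lemma mvars_sum: "mvars (\<Sum>i\<in>I. g i) \<subseteq> (\<Union>i\<in>I. mvars (g i))"
proof (induction I rule: infinite_finite_induct)
  case (insert i I)
  then show ?case using mvars_add[of "g i" "\<Sum>i\<in>I. g i"] by auto
qed simp_all

lemma mvars_prod:
  fixes g :: "'i \<Rightarrow> ('v, 'k::comm_semiring_1) mpoly"
  shows "mvars (\<Prod>i\<in>I. g i) \<subseteq> (\<Union>i\<in>I. mvars (g i))"
proof (induction I rule: infinite_finite_induct)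
  case (insert i I)
  then show ?case using mvars_mult[of "g i" "\<Prod>i\<in>I. g i"] by auto
qed simp_all

lemma mvars_power:
  fixes p :: "('v, 'k::comm_semiring_1) mpoly"
  shows "mvars (p ^ k) \<subseteq> mvars p"
proof (induction k)
  case (Suc k)
  then show ?case using mvars_mult[of p "p ^ k"] by auto
qed simp

lemma mvars_msubst: "mvars (msubst f p) \<subseteq> (\<Union>v\<in>mvars p. mvars (f v))"
proof -
  let ?t = "\<lambda>m. MConst (Poly_Mapping.lookup p m) *
              (\<Prod>v\<in>Poly_Mapping.keys m. f v ^ Poly_Mapping.lookup m v)"
  have *: "mvars (?t m) \<subseteq> (\<Union>v\<in>Poly_Mapping.keys m. mvars (f v))" for m
  proof -
    have "mvars (\<Prod>v\<in>Poly_Mapping.keys m. f v ^ Poly_Mapping.lookup m v)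
        \<subseteq> (\<Union>v\<in>Poly_Mapping.keys m. mvars (f v ^ Poly_Mapping.lookup m v))"
      by (rule mvars_prod)
    also have "\<dots> \<subseteq> (\<Union>v\<in>Poly_Mapping.keys m. mvars (f v))"
      by (intro UN_mono mvars_power order.refl)
    finally show ?thesis
      by (intro order.trans[OF mvars_mult]) simp
  qed
  have "mvars (msubst f p) \<subseteq> (\<Union>m\<in>Poly_Mapping.keys p. mvars (?t m))"
    unfolding msubst_def by (rule mvars_sum)
  also have "\<dots> \<subseteq> (\<Union>m\<in>Poly_Mapping.keys p. \<Union>v\<in>Poly_Mapping.keys m. mvars (f v))"
    by (intro UN_mono * order.refl)
  finally show ?thesis
    by (simp add: mvars_def[of p])
qed

section \<open>The linear forms \<open>x_plus\<close> and the factorizations of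
  \<open>sigma\<close>\<close>

lemma full_tuples_eq_image_PiE:
  "full_tuples n a = (\<lambda>f j. if j \<in> {1..n} then f j else 0) ` (\<Pi>\<^sub>E j\<in>{1..n}. {1..a j})"
  (is "_ = ?ext ` _")
proof (intro equalityI subsetI)
  fix i assume i: "i \<in> full_tuples n a"
  then have "i = ?ext (restrict i {1..n})"
    by (auto simp: full_tuples_def fun_eq_iff)
  moreover have "restrict i {1..n} \<in> (\<Pi>\<^sub>E j\<in>{1..n}. {1..a j})"
    using i by (auto simp: full_tuples_def)
  ultimately show "i \<in> ?ext ` (\<Pi>\<^sub>E j\<in>{1..n}. {1..a j})"
    by blast
qed (auto simp: full_tuples_def PiE_def Pi_def)

lemma finite_full_tuples [simp]: "finite (full_tuples n a)"
  by (simp add: full_tuples_eq_image_PiE finite_PiE)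

text \<open>The summands are grouped by their \<open>j\<close>-th index. This is the source of the
  linear relations in the kernel of \<open>tau\<close>.\<close>

lemma x_plus_eq_sum_x_plus:
  assumes j: "j \<in> {1..n}" and "\<sigma> j = 0"
  shows "x_plus n a \<sigma> = (\<Sum>i=1..a j. x_plus n a (\<sigma>(j := i)))"
proof -
  let ?A = "\<lambda>\<sigma>. {i\<in>full_tuples n a. \<forall>j\<in>{1..n}. \<sigma> j \<noteq> 0 \<longrightarrow> i j = \<sigma> j}"
  have "x_plus n a \<sigma> = (\<Sum>l=1..a j. \<Sum>i\<in>{i\<in>?A \<sigma>. i j = l}. MVar i)"
    unfolding x_plus_def
  proof (intro sum.group[symmetric])
    show "(\<lambda>i. i j) ` ?A \<sigma> \<subseteq> {1..a j}"
      using j by (auto simp: full_tuples_def)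
  qed simp_all
  also have "\<dots> = (\<Sum>l=1..a j. x_plus n a (\<sigma>(j := l)))"
  proof (intro sum.cong refl)
    fix l assume "l \<in> {1..a j}"
    then have "(i \<in> ?A \<sigma> \<and> i j = l) = (i \<in> ?A (\<sigma>(j := l)))" for i
      using assms by (cases "i j = l") auto
    then show "(\<Sum>i\<in>{i\<in>?A \<sigma>. i j = l}. MVar i) = x_plus n a (\<sigma>(j := l))"
      unfolding x_plus_def by (intro sum.cong) blast+
  qed
  finally show ?thesis .
qed

lemma segre_x_plus:
  assumes "\<sigma> \<in> tuples n a"
  shows "msubst (\<lambda>i. \<Prod>j=1..n. MVar (j, i j)) (x_plus n a \<sigma>) = (\<Prod>j=1..n. y_sig a j (\<sigma> j))"
proof -
  \<comment> \<open>The admissible indices at \<open>j\<close>; a singleton makes a plain variable a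
    sum too, so that distributivity applies to all factors uniformly.\<close>
  let ?B = "\<lambda>j. if \<sigma> j = 0 then {1..a j} else {\<sigma> j}"
  let ?ext = "\<lambda>f j. if j \<in> {1..n} then f j else 0"
  have "(\<Prod>j=1..n. y_sig a j (\<sigma> j)) = (\<Prod>j=1..n. \<Sum>l\<in>?B j. MVar (j, l))"
    by (intro prod.cong) (auto simp: y_sig_def)
  also have "\<dots> = (\<Sum>f\<in>Pi\<^sub>E {1..n} ?B. \<Prod>j=1..n. MVar (j, f j))"
    by (intro prod_sum_PiE) auto
  also have "\<dots> = (\<Sum>i\<in>{i\<in>full_tuples n a. \<forall>j\<in>{1..n}. \<sigma> j \<noteq> 0 \<longrightarrow> i j = \<sigma> j}.
      \<Prod>j=1..n. MVar (j, i j))"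
  \<comment> \<open>Elements of \<open>Pi\<^sub>E\<close> are \<open>undefined\<close> outside
    \<open>{1..n}\<close>, tuples are 0 there; restriction and extension by 0 translate between the
    two.\<close>
  proof (rule sum.reindex_bij_witness[of _ "\<lambda>i. restrict i {1..n}" ?ext])
    fix f assume f: "f \<in> Pi\<^sub>E {1..n} ?B"
    then show "restrict (?ext f) {1..n} = f"
      by (auto simp: fun_eq_iff PiE_def extensional_def)
    have "f j \<in> ?B j" if "j \<in> {1..n}" for j
      using f that by blast
    then show "?ext f \<in> {i\<in>full_tuples n a. \<forall>j\<in>{1..n}. \<sigma> j \<noteq> 0 \<longrightarrow> i j = \<sigma> j}"
      using assms by (fastforce simp: full_tuples_def tuples_def split: if_splits)
  qed (auto simp: full_tuples_def fun_eq_iff)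
  finally show ?thesis
    unfolding x_plus_def msubst_sum msubst_MVar by (rule sym)
qed

text \<open>Both sides agree on variables by \<open>segre_x_plus\<close>; membership in
  \<open>S_ring\<close> ensures that only valid tuples occur.\<close>

lemma sigma_eq_segre_tau:
  assumes "p \<in> S_ring n a \<Delta>"
  shows "sigma n a p = msubst (\<lambda>i. \<Prod>j=1..n. MVar (j, i j)) (tau n a p)"
  unfolding sigma_def tau_def msubst_msubst using assms
  by (intro msubst_cong segre_x_plus[symmetric]) (auto simp: S_ring_def S_vars_def)

text \<open>The new variable \<open>(j, 0)\<close> is specialized to the sum of all
  \<open>(j, l)\<close>; the other variables stay fixed.\<close>

lemma sigma_eq_msubst_eta: "sigma n a p = msubst (\<lambda>(j, i). y_sig a j i) (eta n p)"
  unfolding sigma_def eta_def msubst_msubst by (simp add: msubst_prod)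

section \<open>Eliminating the last index in each position\<close>

definition proper_tuples :: "nat \<Rightarrow> (nat \<Rightarrow> nat) \<Rightarrow> (nat \<Rightarrow> nat) set" where
  "proper_tuples n a = {\<sigma>. \<forall>j\<in>{1..n}. \<sigma> j < a j}"

text \<open>The substitution undoes the change of coordinates: it sends the last variable
  \<open>(j, a j)\<close> to \<open>(j, 0)\<close> minus the other \<open>(j, l)\<close>, hence the
  full sum to \<open>(j, 0)\<close>. So on proper tuples the kernel of \<open>sigma\<close> lies in
  that of \<open>eta\<close>.\<close>

lemma eta_eq_msubst_sigma:
  assumes "mvars p \<subseteq> proper_tuples n a"
  shows "eta n p = msubst (\<lambda>(j, i). if i = a j then MVar (j, 0) - (\<Sum>l=1..<a j. MVar (j, l))
           else MVar (j, i)) (sigma n a p)"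
    (is "_ = msubst ?\<theta> _")
proof -
  have "msubst ?\<theta> (y_sig a j i) = MVar (j, i)" if "i < a j" for i j
  proof (cases "i = 0")
    case True
    have "{1..a j} = insert (a j) {1..<a j}"
      using that by auto
    then have "msubst ?\<theta> (y_sig a j i) = ?\<theta> (j, a j) + (\<Sum>l=1..<a j. ?\<theta> (j, l))"
      using True by (simp add: y_sig_def msubst_add msubst_sum)
    also have "(\<Sum>l=1..<a j. ?\<theta> (j, l)) = (\<Sum>l=1..<a j. MVar (j, l))"
      by (intro sum.cong) auto
    finally show ?thesis
      using True by simp
  next
    case False
    then show ?thesis using that by (simp add: y_sig_def)
  qed
  then show ?thesis
    unfolding sigma_def eta_def msubst_msubst msubst_prod using assms
    by (intro msubst_cong prod.cong) (auto simp: proper_tuples_def)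
qed

text \<open>Induction on the number of positions with \<open>\<sigma> j = a j\<close>: at such a
  \<open>j\<close> the linear relation is solved for its term with index \<open>a j\<close>, and
  every other term has fewer such positions.\<close>

lemma x_plus_proper_representative:
  assumes "\<forall>j\<in>{1..n}. 0 < a j" and "simplicial_complex n \<Delta>" and "\<sigma> \<in> S_vars n a \<Delta>"
  shows "\<exists>q :: (nat \<Rightarrow> nat, 'k::comm_ring_1) mpoly.
           mvars q \<subseteq> S_vars n a \<Delta> \<inter> proper_tuples n a \<and> tau n a q = x_plus n a \<sigma>"
  using assms(3)
proof (induction "card {j\<in>{1..n}. \<sigma> j = a j}" arbitrary: \<sigma> rule: less_induct)
  case less
  show ?case
  proof (cases "\<sigma> \<in> proper_tuples n a")
    case True
    then show ?thesis
      using less.prems by (intro exI[of _ "MVar \<sigma>"]) (simp add: tau_def)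
  next
    case False
    then obtain j where j: "j \<in> {1..n}" "\<sigma> j = a j"
      using less.prems by (fastforce simp: proper_tuples_def S_vars_def tuples_def)
    have aj: "0 < a j" using assms(1) j by blast
    have "\<exists>q :: (nat \<Rightarrow> nat, 'k) mpoly. mvars q \<subseteq> S_vars n a \<Delta> \<inter> proper_tuples n a \<and>
            tau n a q = x_plus n a (\<sigma>(j := i))" if i: "i < a j" for i
    proof (rule less.hyps)
      have "{l\<in>{1..n}. (\<sigma>(j := i)) l = a l} \<subset> {l\<in>{1..n}. \<sigma> l = a l}"
        using i j by (auto split: if_splits)
      then show "card {l\<in>{1..n}. (\<sigma>(j := i)) l = a l} < card {l\<in>{1..n}. \<sigma> l = a l}"
        by (intro psubset_card_mono) auto
      \<comment> \<open>As \<open>\<sigma> j = a j > 0\<close>, position \<open>j\<close> is already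
        in the support, so no new value there enlarges it and \<Delta> still contains it.\<close>
      have "support n (\<sigma>(j := i)) \<subseteq> support n \<sigma>"
        using j aj by (auto simp: support_def split: if_splits)
      then have "support n (\<sigma>(j := i)) \<in> \<Delta>"
        using assms(2) less.prems unfolding simplicial_complex_def S_vars_def by blast
      moreover have "\<sigma>(j := i) \<in> tuples n a"
        using less.prems i j by (auto simp: S_vars_def tuples_def)
      ultimately show "\<sigma>(j := i) \<in> S_vars n a \<Delta>"
        by (simp add: S_vars_def)
    qed
    then obtain q :: "nat \<Rightarrow> (nat \<Rightarrow> nat, 'k) mpoly" where
      q: "\<And>i. i < a j \<Longrightarrow> mvars (q i) \<subseteq> S_vars n a \<Delta> \<inter> proper_tuples n a"
         "\<And>i. i < a j \<Longrightarrow> tau n a (q i) = x_plus n a (\<sigma>(j := i))"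
      by metis
    have "mvars (\<Sum>i=1..<a j. q i) \<subseteq> S_vars n a \<Delta> \<inter> proper_tuples n a"
      using q(1) by (intro order.trans[OF mvars_sum]) fastforce
    then have "mvars (q 0 - (\<Sum>i=1..<a j. q i)) \<subseteq> S_vars n a \<Delta> \<inter> proper_tuples n a"
      using q(1)[OF aj] by (intro order.trans[OF mvars_diff]) simp
    moreover have "tau n a (q 0 - (\<Sum>i=1..<a j. q i)) = x_plus n a \<sigma>"
    proof -
      have "x_plus n a (\<sigma>(j := 0)) = (\<Sum>i=1..a j. x_plus n a (\<sigma>(j := i)) :: (_, 'k) mpoly)"
        using x_plus_eq_sum_x_plus[OF j(1), of "\<sigma>(j := 0)"] by simp
      \<comment> \<open>The term split off belongs to \<sigma> itself, because
        \<open>\<sigma>(j := a j) = \<sigma>\<close>.\<close>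
      also have "{1..a j} = insert (a j) {1..<a j}"
        using aj by auto
      also have "(\<Sum>i\<in>\<dots>. x_plus n a (\<sigma>(j := i)) :: (_, 'k) mpoly)
          = x_plus n a \<sigma> + (\<Sum>i=1..<a j. x_plus n a (\<sigma>(j := i)))"
        using j(2) by (simp add: fun_upd_idem)
      finally have "x_plus n a (\<sigma>(j := 0)) - (\<Sum>i=1..<a j. x_plus n a (\<sigma>(j := i)))
          = (x_plus n a \<sigma> :: (_, 'k) mpoly)"
        by (simp only: add_diff_cancel_right')
      moreover have "tau n a (q 0 - (\<Sum>i=1..<a j. q i))
          = x_plus n a (\<sigma>(j := 0)) - (\<Sum>i=1..<a j. x_plus n a (\<sigma>(j := i)))"
        using q(2) aj by (simp add: tau_def msubst_diff msubst_sum)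
      ultimately show ?thesis
        by (simp only:)
    qed
    ultimately show ?thesis by blast
  qed
qed

text \<open>Replacing each variable by its representative does not change \<open>tau\<close>. Thus
  every \<open>p\<close> is congruent, modulo the kernel of \<open>tau\<close>, to a polynomial
  covered by \<open>eta_eq_msubst_sigma\<close>.\<close>

lemma tau_proper_representative:
  assumes "\<forall>j\<in>{1..n}. 0 < a j" and "simplicial_complex n \<Delta>"
    and "(p :: (nat \<Rightarrow> nat, 'k::comm_ring_1) mpoly) \<in> S_ring n a \<Delta>"
  obtains q where "q \<in> S_ring n a \<Delta>" "mvars q \<subseteq> proper_tuples n a" "tau n a q = tau n a p"
proof -
  obtain r :: "(nat \<Rightarrow> nat) \<Rightarrow> (nat \<Rightarrow> nat, 'k) mpoly" where
    r: "\<And>\<sigma>. \<sigma> \<in> S_vars n a \<Delta> \<Longrightarrow> mvars (r \<sigma>) \<subseteq> S_vars n a \<Delta> \<inter> proper_tuples n a"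
       "\<And>\<sigma>. \<sigma> \<in> S_vars n a \<Delta> \<Longrightarrow> tau n a (r \<sigma>) = x_plus n a \<sigma>"
    using x_plus_proper_representative[OF assms(1,2), where 'k = 'k] by metis
  have p: "mvars p \<subseteq> S_vars n a \<Delta>"
    using assms(3) by (simp add: S_ring_def)
  have "mvars (msubst r p) \<subseteq> S_vars n a \<Delta> \<inter> proper_tuples n a"
    using p r(1) by (intro order.trans[OF mvars_msubst]) blast
  moreover have "tau n a (msubst r p) = tau n a p"
    unfolding tau_def msubst_msubst using p r(2)
    by (intro msubst_cong) (auto simp: tau_def)
  ultimately show ?thesis
    using that[of "msubst r p"] by (simp add: S_ring_def)
qed

theorem theorem5p1:
  fixes n :: nat and a :: "nat \<Rightarrow> nat" and \<Delta> :: "nat set set"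
  assumes "\<forall>j\<in>{1..n}. 0 < a j"
    and "simplicial_complex n \<Delta>"
  shows "kernel_in (S_ring n a \<Delta>) (sigma n a :: (nat \<Rightarrow> nat, 'k::field) mpoly \<Rightarrow> _)
       = radical_in (S_ring n a \<Delta>)
           (ideal_sum (kernel_in (S_ring n a \<Delta>) (tau n a :: (nat \<Rightarrow> nat, 'k) mpoly \<Rightarrow> _))
                      (kernel_in (S_ring n a \<Delta>) (eta n :: (nat \<Rightarrow> nat, 'k) mpoly \<Rightarrow> _)))"
    (is "?P = radical_in ?S (ideal_sum ?K ?Q)")
proof (intro equalityI subsetI)
  fix p :: "(nat \<Rightarrow> nat, 'k) mpoly"
  assume "p \<in> ?P"
  then have p: "p \<in> ?S" "sigma n a p = 0"
    by (auto simp: kernel_in_def)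
  obtain q where q: "q \<in> ?S" "mvars q \<subseteq> proper_tuples n a" "tau n a q = tau n a p"
    using tau_proper_representative[OF assms p(1)] .
  have "p - q \<in> ?K"
    using p(1) q mvars_diff[of p q] by (auto simp: kernel_in_def S_ring_def tau_def msubst_diff)
  \<comment> \<open>\<open>sigma\<close> factors through \<open>tau\<close>, so
    \<open>sigma n a q = sigma n a p = 0\<close>; the inverse coordinate change then gives
    \<open>eta n q = 0\<close>.\<close>
  moreover have "q \<in> ?Q"
    using p q eta_eq_msubst_sigma[OF q(2)]
    by (simp add: kernel_in_def sigma_eq_segre_tau[OF q(1)] sigma_eq_segre_tau[OF p(1)])
  ultimately have "(p - q) + q \<in> ideal_sum ?K ?Q"
    unfolding ideal_sum_def by blast
  \<comment> \<open>Exponent 1 suffices, since \<open>p\<close> itself lies in the sum.\<close>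
  then have "p ^ 1 \<in> ideal_sum ?K ?Q"
    by simp
  then show "p \<in> radical_in ?S (ideal_sum ?K ?Q)"
    using p(1) unfolding radical_in_def by blast
next
  fix p :: "(nat \<Rightarrow> nat, 'k) mpoly"
  assume "p \<in> radical_in ?S (ideal_sum ?K ?Q)"
  then obtain k u v where p: "p \<in> ?S" and uv: "p ^ k = u + v" "u \<in> ?K" "v \<in> ?Q"
    by (auto simp: radical_in_def ideal_sum_def)
  have "sigma n a u = 0"
    using uv(2) by (auto simp: kernel_in_def sigma_eq_segre_tau)
  moreover have "sigma n a v = 0"
    using uv(3) by (auto simp: kernel_in_def sigma_eq_msubst_eta)
  ultimately have "sigma n a (p ^ k) = 0"
    unfolding uv(1) by (simp add: sigma_def msubst_add)
  then have "sigma n a p ^ k = 0"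
    by (simp add: sigma_def msubst_power)
  \<comment> \<open>The instance \<open>idom\<close> needs a linear order on the variables \<open>(j, i)\<close>, which comes from the
    lexicographic order on pairs.\<close>
  then have "sigma n a p = 0"
    by simp
  then show "p \<in> ?P"
    using p by (simp add: kernel_in_def)
qed

end
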